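(* Let $P_n$ be the path graph on $n$ vertices, with adjacency matrix $A$, and let $0<\alpha<1/\rho(A)$. Then, for vertices $i,j$ of $P_n$, \[ K_{P_n}(\alpha)_{i,j}=\frac{\alpha^{j-i}\,d_{i-1}(\alpha)\,d_{n-j}(\alpha)}{d_n(\alpha)}. \]
   Context: For a simple graph $G$ with adjacency matrix $A$, spectral radius $\rho(A)$, and $0<\alpha<1/\rho(A)$, the Katz matrix is $K_G(\alpha)=\sum_{t=1}^\infty \alpha^tA^t=(I-\alpha A)^{-1}-I$, and the Katz similarity index between vertices $i$ and $j$ is the entry $K_G(\alpha)_{i,j}$. $P_n$ is the path graph on vertices $1,\dots,n$ with edges $\{i,i+1\}$, $1\le i<n$. For integers $i\ge0$, $d_i(\alpha)=\sum_{m=0}^{\lfloor i/2\rfloor}(-1)^m\binom{i-m}{m}\alpha^{2m}$.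
   Formalization: The formula is stated only for vertices i < j; it fails as printed for i = j (K_{i,i} is the right-hand side minus 1, e.g. n = 2, i = j = 1) and for i > j (the right-hand side is not symmetric, while K is). *)

theory Defs
  imports "Jordan_Normal_Form.Spectral_Radius"
begin

text \<open>
  A simple graph on the vertex set \<open>{1..n}\<close> is given by its set of edges, each edge being a
  two-element set of vertices. Matrix indices start at 0, so vertex \<open>i\<close> has index \<open>i - 1\<close>.
\<close>

definition path_graph :: "nat \<Rightarrow> nat set set" where
  "path_graph n = {{i, i + 1} | i. 1 \<le> i \<and> i < n}"

definition adjacency_matrix :: "nat \<Rightarrow> nat set set \<Rightarrow> real mat" where
  "adjacency_matrix n E = mat n n (\<lambda>(i, j). if {i + 1, j + 1} \<in> E then 1 else 0)"

definition real_spectral_radius :: "real mat \<Rightarrow> real" where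
  "real_spectral_radius A = spectral_radius (map_mat complex_of_real A)"

text \<open>The series over \<open>t \<ge> 1\<close> is taken entrywise and reindexed to start at \<open>t = 0\<close>.\<close>

definition katz_matrix :: "nat \<Rightarrow> nat set set \<Rightarrow> real \<Rightarrow> real mat" where
  "katz_matrix n E \<alpha> = mat n n (\<lambda>(i, j).
     \<Sum>t. (\<alpha> ^ Suc t \<cdot>\<^sub>m (adjacency_matrix n E ^\<^sub>m Suc t)) $$ (i, j))"

definition katz_index :: "nat \<Rightarrow> nat set set \<Rightarrow> real \<Rightarrow> nat \<Rightarrow> nat \<Rightarrow> real" where
  "katz_index n E \<alpha> i j = katz_matrix n E \<alpha> $$ (i - 1, j - 1)"

definition d_poly :: "nat \<Rightarrow> real \<Rightarrow> real" where
  "d_poly i \<alpha> = (\<Sum>m = 0..i div 2. (- 1) ^ m * real ((i - m) choose m) * \<alpha> ^ (2 * m))"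

end

theory Submission
  imports Defs
begin

text \<open>
  The matrix \<open>d\<^sub>n(\<alpha>) (I - \<alpha> A)\<^sup>-\<^sup>1\<close> is guessed in closed form and checked, entry by entry, to give
  \<open>d\<^sub>n(\<alpha>) I\<close> when multiplied by \<open>I - \<alpha> A\<close>; this only uses \<open>d\<^bsub>n+2\<^esub> = d\<^bsub>n+1\<^esub> - \<alpha>\<^sup>2 d\<^sub>n\<close> and its consequence \<open>d_poly_add\<close>.
  Since \<open>I + K\<close> is a left inverse of \<open>I - \<alpha> A\<close>, the guess \<open>G\<close> satisfies \<open>G = d\<^sub>n(\<alpha>) (I + K)\<close>.
  The corner entry of \<open>G\<close> is \<open>\<alpha>\<^bsup>n-1\<^esup> \<noteq> 0\<close>, so \<open>d\<^sub>n(\<alpha>) \<noteq> 0\<close> without any determinant computation.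
\<close>

lemma d_poly_0 [simp]: "d_poly 0 \<alpha> = 1"
  by (simp add: d_poly_def)

lemma d_poly_1 [simp]: "d_poly (Suc 0) \<alpha> = 1"
  by (simp add: d_poly_def)

text \<open>Pascal's rule, applied to the coefficient of each power of
  \<open>\<alpha>\<close>.\<close>

lemma d_poly_Suc_Suc: "d_poly (Suc (Suc n)) \<alpha> = d_poly (Suc n) \<alpha> - \<alpha>\<^sup>2 * d_poly n \<alpha>"
proof -
  define f where "f n m = (- 1) ^ m * real ((n - m) choose m) * \<alpha> ^ (2 * m)" for n m
  \<comment> \<open>The binomial coefficients vanish beyond \<open>n div 2\<close>, so the three
    sums can be brought to matching ranges.\<close>
  have d: "d_poly n \<alpha> = (\<Sum>m\<le>N. f n m)" if "n div 2 \<le> N" "N \<le> n" for n N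
    unfolding d_poly_def f_def[symmetric] atLeast0AtMost
    by (rule sum.mono_neutral_left) (use that in \<open>auto simp: f_def binomial_eq_0_iff\<close>)
  have step: "f (Suc (Suc n)) (Suc m) = f (Suc n) (Suc m) - \<alpha>\<^sup>2 * f n m" if "m \<le> n" for m
    using that by (simp add: f_def Suc_diff_le power2_eq_square algebra_simps)
  have "d_poly (Suc (Suc n)) \<alpha> = f (Suc (Suc n)) 0 + (\<Sum>m\<le>n. f (Suc (Suc n)) (Suc m))"
    by (subst d[of _ "Suc n"]) (auto simp: sum.atMost_Suc_shift simp del: sum.atMost_Suc)
  also have "\<dots> = (f (Suc n) 0 + (\<Sum>m\<le>n. f (Suc n) (Suc m))) - \<alpha>\<^sup>2 * (\<Sum>m\<le>n. f n m)"
    by (simp add: step sum_subtractf sum_distrib_left f_def[of _ 0])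
  also have "f (Suc n) 0 + (\<Sum>m\<le>n. f (Suc n) (Suc m)) = d_poly (Suc n) \<alpha>"
    by (subst d[of _ "Suc n"]) (auto simp: sum.atMost_Suc_shift simp del: sum.atMost_Suc)
  also have "(\<Sum>m\<le>n. f n m) = d_poly n \<alpha>"
    by (subst d[of _ n]) auto
  finally show ?thesis .
qed

text \<open>\<open>d_poly n\<close> sums \<open>(- \<alpha>^2)^m\<close> over the matchings of the
  path on \<open>n\<close> vertices, \<open>m\<close> being the number of edges. A matching of the
  joined path either avoids or contains the joining edge, which explains the two terms. The
  induction moves one vertex at a time across that edge.\<close>

lemma d_poly_add:
  "d_poly (Suc (Suc (a + b))) \<alpha> = d_poly (Suc a) \<alpha> * d_poly (Suc b) \<alpha> - \<alpha>\<^sup>2 * d_poly a \<alpha> * d_poly b \<alpha>"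
proof (induction a arbitrary: b)
  case 0
  show ?case by (simp add: d_poly_Suc_Suc)
next
  case (Suc a)
  show ?case using Suc[of "Suc b"] by (simp add: d_poly_Suc_Suc algebra_simps)
qed

text \<open>An eigenvalue \<open>k\<close> of the scaled matrix gives the eigenvalue
  \<open>k / c\<close> of \<open>A\<close>, with the same eigenvector.\<close>

lemma spectral_radius_smult_less_1:
  assumes A: "A \<in> carrier_mat n n" and n: "n \<noteq> 0" and c: "c \<noteq> 0"
    and less: "norm c * spectral_radius A < 1"
  shows "spectral_radius (c \<cdot>\<^sub>m A) < 1"
proof -
  have cA: "c \<cdot>\<^sub>m A \<in> carrier_mat n n" using A by simp
  from spectral_radius_mem_max(1)[OF cA] n
  obtain k where k: "eigenvalue (c \<cdot>\<^sub>m A) k" and eq: "spectral_radius (c \<cdot>\<^sub>m A) = norm k"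
    by (auto simp: spectrum_def)
  then obtain v where v: "v \<in> carrier_vec n" "v \<noteq> 0\<^sub>v n" and "c \<cdot>\<^sub>m A *\<^sub>v v = k \<cdot>\<^sub>v v"
    using A by (auto simp: eigenvalue_def eigenvector_def)
  moreover have "c \<cdot>\<^sub>m A *\<^sub>v v = c \<cdot>\<^sub>v (A *\<^sub>v v)"
    using A v by (intro eq_vecI) auto
  ultimately have "c \<cdot>\<^sub>v (A *\<^sub>v v) = k \<cdot>\<^sub>v v"
    using A by simp
  then have "inverse c \<cdot>\<^sub>v (c \<cdot>\<^sub>v (A *\<^sub>v v)) = inverse c \<cdot>\<^sub>v (k \<cdot>\<^sub>v v)" by simp
  then have "A *\<^sub>v v = (k / c) \<cdot>\<^sub>v v"
    using c by (simp add: smult_smult_assoc divide_inverse mult.commute)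
  then have "eigenvalue A (k / c)"
    using v A by (auto simp: eigenvalue_def eigenvector_def)
  then have "norm (k / c) \<le> spectral_radius A"
    using spectral_radius_mem_max(2)[OF A, of "norm (k / c)"] n by (auto simp: spectrum_def)
  then have "norm k \<le> norm c * spectral_radius A"
    using c by (simp add: norm_divide field_simps)
  with less eq show ?thesis by simp
qed

lemma smult_pow_mat:
  assumes "A \<in> carrier_mat n n"
  shows "(c \<cdot>\<^sub>m A) ^\<^sub>m k = (c :: 'a :: comm_ring_1) ^ k \<cdot>\<^sub>m A ^\<^sub>m k"
proof (induction k)
  case 0
  show ?case using assms by auto
next
  case (Suc k)
  have "A ^\<^sub>m k \<in> carrier_mat n n" using assms by simp
  with Suc assms show ?case
    by (auto simp: mult_smult_distrib[of _ n n _ n] mult_smult_assoc_mat[of _ n n _ n] ac_simps)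
qed

lemma summable_smult_pow_mat:
  assumes A: "A \<in> carrier_mat n n" and \<alpha>: "0 < \<alpha>" "\<alpha> < 1 / real_spectral_radius A"
    and i: "i < n" and j: "j < n"
  shows "summable (\<lambda>t. (\<alpha> ^ t \<cdot>\<^sub>m A ^\<^sub>m t) $$ (i, j))"
proof -
  let ?\<rho> = "real_spectral_radius A"
  let ?B = "map_mat complex_of_real A"
  \<comment> \<open>The powers of \<open>\<beta> A\<close> are bounded, so the series is dominated by a geometric one of ratio \<open>\<alpha> / \<beta>\<close>.\<close>
  obtain \<beta> where \<beta>: "\<alpha> < \<beta>" "\<beta> < 1 / ?\<rho>"
    using \<alpha>(2) dense by blast
  have B: "?B \<in> carrier_mat n n" using A by simp
  \<comment> \<open>Since \<open>1 / 0 = 0\<close> here, the bounds on \<open>\<alpha>\<close>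
    already force a positive radius.\<close>
  have "0 < ?\<rho>"
    using \<alpha> by (metis less_trans zero_less_divide_1_iff)
  then have "\<beta> * ?\<rho> < 1" using \<beta> by (simp add: field_simps)
  then have "spectral_radius (complex_of_real \<beta> \<cdot>\<^sub>m ?B) < 1"
    using \<alpha> \<beta> i by (intro spectral_radius_smult_less_1[OF B]) (auto simp: real_spectral_radius_def)
  from spectral_radius_jnf_norm_bound_less_1_upper_triangular[OF _ this, of n] B
  obtain c where c: "norm_bound ((complex_of_real \<beta> \<cdot>\<^sub>m ?B) ^\<^sub>m t) c" for t
    by auto
  have At: "A ^\<^sub>m t \<in> carrier_mat n n" for t using A by simp
  have bound: "norm ((\<alpha> ^ t \<cdot>\<^sub>m A ^\<^sub>m t) $$ (i, j)) \<le> c * (\<alpha> / \<beta>) ^ t" for t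
  proof -
    have "(complex_of_real \<beta> \<cdot>\<^sub>m ?B) ^\<^sub>m t = complex_of_real \<beta> ^ t \<cdot>\<^sub>m map_mat complex_of_real (A ^\<^sub>m t)"
      by (simp add: smult_pow_mat[OF B] of_real_hom.mat_hom_pow[OF A])
    then have "norm (complex_of_real \<beta> ^ t * complex_of_real ((A ^\<^sub>m t) $$ (i, j))) \<le> c"
      using c[of t] i j A At[of t] by (auto simp: norm_bound_def)
    then have "\<beta> ^ t * \<bar>(A ^\<^sub>m t) $$ (i, j)\<bar> \<le> c"
      using \<alpha> \<beta> by (simp add: norm_mult norm_power)
    then have "(\<alpha> / \<beta>) ^ t * (\<beta> ^ t * \<bar>(A ^\<^sub>m t) $$ (i, j)\<bar>) \<le> (\<alpha> / \<beta>) ^ t * c"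
      using \<alpha> \<beta> by (intro mult_left_mono) auto
    then show ?thesis
      using \<alpha> \<beta> i j A At[of t] by (auto simp: power_divide abs_mult mult.commute)
  qed
  show ?thesis
    by (rule summable_comparison_test'[OF _ bound]) (use \<alpha> \<beta> in \<open>auto intro!: summable_mult summable_geometric\<close>)
qed

text \<open>\<open>1\<^sub>m n + K\<close> is the full series from \<open>t = 0\<close>; multiplying
  it by \<open>\<alpha> \<cdot>\<^sub>m A\<close> shifts the series by one and leaves
  \<open>K\<close>.\<close>

lemma katz_matrix_resolvent:
  fixes n E \<alpha>
  defines "A \<equiv> adjacency_matrix n E"
  assumes \<alpha>: "0 < \<alpha>" "\<alpha> < 1 / real_spectral_radius A"
  shows "(1\<^sub>m n + katz_matrix n E \<alpha>) * (1\<^sub>m n - \<alpha> \<cdot>\<^sub>m A) = 1\<^sub>m n"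
proof -
  define K where "K = katz_matrix n E \<alpha>"
  define a where "a t i j = (\<alpha> ^ t \<cdot>\<^sub>m A ^\<^sub>m t) $$ (i, j)" for t i j
  have A: "A \<in> carrier_mat n n" by (simp add: A_def adjacency_matrix_def)
  have K: "K \<in> carrier_mat n n" by (simp add: K_def katz_matrix_def)
  have At: "A ^\<^sub>m t \<in> carrier_mat n n" for t using A by simp
  have summable: "summable (\<lambda>t. a t i j)" if "i < n" "j < n" for i j
    unfolding a_def using summable_smult_pow_mat[OF A \<alpha> that] .
  have K_index: "K $$ (i, j) = (\<Sum>t. a (Suc t) i j)" if "i < n" "j < n" for i j
    using that by (simp add: K_def katz_matrix_def a_def A_def)
  have a_0: "a 0 i j = (1\<^sub>m n) $$ (i, j)" if "i < n" "j < n" for i j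
    using that A by (simp add: a_def)
  have S_index: "(1\<^sub>m n + K) $$ (i, j) = (\<Sum>t. a t i j)" if "i < n" "j < n" for i j
    using suminf_split_head[OF summable[OF that]] K that
    by (simp add: K_index a_0)
  have a_Suc: "a (Suc t) i j = (\<Sum>k<n. a t i k * (\<alpha> * A $$ (k, j)))" if "i < n" "j < n" for t i j
    using that A At[of t]
    by (simp add: a_def scalar_prod_def atLeast0LessThan sum_distrib_left mult_ac)
  have "(1\<^sub>m n + K) * (\<alpha> \<cdot>\<^sub>m A) = K"
  proof (rule eq_matI)
    fix i j assume "i < dim_row K" "j < dim_col K"
    then have ij: "i < n" "j < n" using K by auto
    have "((1\<^sub>m n + K) * (\<alpha> \<cdot>\<^sub>m A)) $$ (i, j) = (\<Sum>k<n. (1\<^sub>m n + K) $$ (i, k) * (\<alpha> * A $$ (k, j)))"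
      using ij A K by (simp add: scalar_prod_def atLeast0LessThan eq_commute[of i])
    also have "\<dots> = (\<Sum>k<n. \<Sum>t. a t i k * (\<alpha> * A $$ (k, j)))"
      using ij by (intro sum.cong refl) (simp only: S_index suminf_mult2[OF summable] lessThan_iff)
    also have "\<dots> = (\<Sum>t. \<Sum>k<n. a t i k * (\<alpha> * A $$ (k, j)))"
      using ij by (intro suminf_sum[symmetric] summable_mult2 summable) auto
    also have "\<dots> = K $$ (i, j)"
      using ij by (simp add: K_index a_Suc)
    finally show "((1\<^sub>m n + K) * (\<alpha> \<cdot>\<^sub>m A)) $$ (i, j) = K $$ (i, j)" .
  qed (use A K in auto)
  moreover have "(1\<^sub>m n + K) * (1\<^sub>m n - \<alpha> \<cdot>\<^sub>m A) = (1\<^sub>m n + K) * 1\<^sub>m n - (1\<^sub>m n + K) * (\<alpha> \<cdot>\<^sub>m A)"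
    using A K by (intro mult_minus_distrib_mat) auto
  ultimately show ?thesis
    unfolding K_def[symmetric] using K by auto
qed

text \<open>Indices start at 0 here, as for matrices: \<open>path_green n \<alpha> i j\<close> belongs to the vertices \<open>i + 1\<close> and \<open>j + 1\<close>.\<close>

definition path_green :: "nat \<Rightarrow> real \<Rightarrow> nat \<Rightarrow> nat \<Rightarrow> real" where
  "path_green n \<alpha> i j = (if i \<le> j then \<alpha> ^ (j - i) * d_poly i \<alpha> * d_poly (n - Suc j) \<alpha>
     else \<alpha> ^ (i - j) * d_poly j \<alpha> * d_poly (n - Suc i) \<alpha>)"

text \<open>This is the equation for one entry of the product with \<open>I - \<alpha> A\<close>.
  Off the diagonal only one \<open>d_poly\<close> factor varies with \<open>i\<close>, and its
  three-term recurrence gives 0; at an end of the path, \<open>d_poly 0 = d_poly 1\<close> takes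
  over.\<close>

lemma path_green_rec:
  assumes "i < n" "j < n"
  shows "path_green n \<alpha> i j
      - \<alpha> * ((if 0 < i then path_green n \<alpha> (i - 1) j else 0)
           + (if Suc i < n then path_green n \<alpha> (Suc i) j else 0))
    = (if i = j then d_poly n \<alpha> else 0)"
proof -
  consider (lt) "i < j" | (eq) "i = j" | (gt) "j < i" by linarith
  then show ?thesis
  proof cases
    case lt
    then obtain k where j: "j = Suc (i + k)" by (auto dest: less_imp_Suc_add)
    show ?thesis
    proof (cases i)
      case 0
      then show ?thesis using assms j by (simp add: path_green_def)
    next
      case (Suc i')
      then show ?thesis using assms j
        by (simp add: path_green_def Suc_diff_le d_poly_Suc_Suc power2_eq_square algebra_simps)
    qed
  next
    case gt
    then obtain k where i: "i = Suc (j + k)" by (auto dest: less_imp_Suc_add)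
    obtain m where n: "n = Suc (i + m)" using assms by (auto dest: less_imp_Suc_add)
    show ?thesis
    proof (cases m)
      case 0
      then show ?thesis using i n by (simp add: path_green_def Suc_diff_le)
    next
      case (Suc m')
      then show ?thesis using i n
        by (simp add: path_green_def Suc_diff_le d_poly_Suc_Suc power2_eq_square algebra_simps)
    qed
  next
    case eq
    obtain m where n: "n = Suc (i + m)" using assms by (auto dest: less_imp_Suc_add)
    show ?thesis
    proof (cases i; cases m)
      fix i' m' assume "i = Suc i'" "m = Suc m'"
      \<comment> \<open>The term from the left neighbour turns the factor \<open>d_poly i\<close>
        into \<open>d_poly (Suc i)\<close>; \<open>d_poly_add\<close> then joins the two sides
        across the edge to the right neighbour.\<close>
      then show ?thesis using eq n d_poly_add[of "Suc i'" "m'" \<alpha>]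
        by (simp add: path_green_def d_poly_Suc_Suc power2_eq_square algebra_simps)
    qed (use eq n in \<open>auto simp: path_green_def d_poly_Suc_Suc power2_eq_square algebra_simps\<close>)
  qed
qed

lemma path_resolvent_mult_green:
  "(1\<^sub>m n - \<alpha> \<cdot>\<^sub>m adjacency_matrix n (path_graph n)) * mat n n (\<lambda>(i, j). path_green n \<alpha> i j)
    = d_poly n \<alpha> \<cdot>\<^sub>m 1\<^sub>m n" (is "(_ - _ \<cdot>\<^sub>m ?A) * ?G = _")
proof (rule eq_matI)
  fix i j assume "i < dim_row (d_poly n \<alpha> \<cdot>\<^sub>m 1\<^sub>m n)" "j < dim_col (d_poly n \<alpha> \<cdot>\<^sub>m 1\<^sub>m n)"
  then have ij: "i < n" "j < n" by auto
  have A: "?A \<in> carrier_mat n n" by (simp add: adjacency_matrix_def)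
  \<comment> \<open>For \<open>i = 0\<close> truncated subtraction gives \<open>i - 1 = 0\<close>;
    the guard \<open>0 < i\<close> keeps this from counting as a loop.\<close>
  have adj: "?A $$ (i, k) = (if 0 < i \<and> k = i - 1 then 1 else 0) + (if k = Suc i then 1 else 0)"
    if "k < n" for k
    using ij that by (auto simp: adjacency_matrix_def path_graph_def doubleton_eq_iff)
  have "((1\<^sub>m n - \<alpha> \<cdot>\<^sub>m ?A) * ?G) $$ (i, j)
      = (\<Sum>k<n. ((if k = i then 1 else 0) - \<alpha> * ?A $$ (i, k)) * path_green n \<alpha> k j)"
    using ij A by (simp add: scalar_prod_def atLeast0LessThan eq_commute[of i])
  also have "\<dots> = (\<Sum>k<n. (if k = i then path_green n \<alpha> k j else 0)
      - \<alpha> * ((if k = i - 1 then if 0 < i then path_green n \<alpha> k j else 0 else 0)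
        + (if k = Suc i then path_green n \<alpha> k j else 0)))"
    by (intro sum.cong refl) (auto simp: adj algebra_simps)
  also have "\<dots> = path_green n \<alpha> i j
      - \<alpha> * ((if 0 < i then path_green n \<alpha> (i - 1) j else 0)
           + (if Suc i < n then path_green n \<alpha> (Suc i) j else 0))"
    using ij by (simp add: sum_subtractf sum.distrib flip: sum_distrib_left)
  also have "\<dots> = (d_poly n \<alpha> \<cdot>\<^sub>m 1\<^sub>m n) $$ (i, j)"
    using ij by (simp add: path_green_rec)
  finally show "((1\<^sub>m n - \<alpha> \<cdot>\<^sub>m ?A) * ?G) $$ (i, j) = (d_poly n \<alpha> \<cdot>\<^sub>m 1\<^sub>m n) $$ (i, j)" .
qed (auto simp: adjacency_matrix_def)

theorem theorem9:
  fixes n i j :: nat and \<alpha> :: real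
  assumes "0 < \<alpha>"
    and "\<alpha> < 1 / real_spectral_radius (adjacency_matrix n (path_graph n))"
    and "1 \<le> i" and "i < j" and "j \<le> n"
  shows "katz_index n (path_graph n) \<alpha> i j
    = \<alpha> ^ (j - i) * d_poly (i - 1) \<alpha> * d_poly (n - j) \<alpha> / d_poly n \<alpha>"
proof -
  let ?A = "adjacency_matrix n (path_graph n)"
  let ?K = "katz_matrix n (path_graph n) \<alpha>"
  let ?G = "mat n n (\<lambda>(i, j). path_green n \<alpha> i j)"
  have A: "?A \<in> carrier_mat n n" by (simp add: adjacency_matrix_def)
  have K: "?K \<in> carrier_mat n n" by (simp add: katz_matrix_def)
  have "?G = ((1\<^sub>m n + ?K) * (1\<^sub>m n - \<alpha> \<cdot>\<^sub>m ?A)) * ?G"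
    using katz_matrix_resolvent[OF assms(1,2)] by simp
  also have "\<dots> = (1\<^sub>m n + ?K) * (d_poly n \<alpha> \<cdot>\<^sub>m 1\<^sub>m n)"
    using A K by (subst assoc_mult_mat[of _ n n _ n _ n]) (auto simp: path_resolvent_mult_green)
  also have "\<dots> = d_poly n \<alpha> \<cdot>\<^sub>m (1\<^sub>m n + ?K)"
    using K by (subst mult_smult_distrib[of _ n n _ n]) auto
  finally have G: "?G = d_poly n \<alpha> \<cdot>\<^sub>m (1\<^sub>m n + ?K)" .
  have green: "path_green n \<alpha> k l = d_poly n \<alpha> * ((if k = l then 1 else 0) + ?K $$ (k, l))"
    if "k < n" "l < n" for k l
    using that K arg_cong[OF G, of "\<lambda>M. M $$ (k, l)"] by simp
  have "path_green n \<alpha> 0 (n - 1) = \<alpha> ^ (n - 1)"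
    using assms by (simp add: path_green_def)
  then have "d_poly n \<alpha> \<noteq> 0"
    using green[of 0 "n - 1"] assms by auto
  \<comment> \<open>As \<open>i < j\<close>, the entry is off the diagonal, so the identity
    contributes nothing and the first branch of \<open>path_green\<close> applies.\<close>
  then show ?thesis
    using green[of "i - 1" "j - 1"] assms
    by (cases i; cases j) (auto simp: katz_index_def path_green_def field_simps)
qed

end
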